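(* Let $k\geq 1$ be an integer and let $D$ be a $k$-degenerate directed graph. Then $f(D)\leq \frac{k-1}{k+1}\,n(D)$.
   Context: Directed graphs are oriented graphs: finite, no loops, no multiple arcs and no pair of antiparallel arcs. $n(D)$ is the number of vertices and $f(D)$ is the minimum size of a set $F\subseteq V(D)$ such that $D-F$ contains no directed cycle. A directed graph is $k$-degenerate if its underlying undirected graph is $k$-degenerate, i.e. has an ordering of the vertices in which every vertex has at most $k$ neighbours preceding it. *)

theory Defs
  imports Complex_Main
begin

definition oriented_graph :: "'a set \<Rightarrow> ('a \<times> 'a) set \<Rightarrow> bool" where
  "oriented_graph V A \<longleftrightarrow> finite V \<and> A \<subseteq> V \<times> V \<and>
     (\<forall>u v. (u, v) \<in> A \<longrightarrow> u \<noteq> v \<and> (v, u) \<notin> A)"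

definition del_vertices :: "'a set \<Rightarrow> ('a \<times> 'a) set \<Rightarrow> 'a set \<Rightarrow> ('a \<times> 'a) set" where
  "del_vertices V A F = A \<inter> ((V - F) \<times> (V - F))"

definition fvs_number :: "'a set \<Rightarrow> ('a \<times> 'a) set \<Rightarrow> nat" where
  "fvs_number V A = Min {card F | F. F \<subseteq> V \<and> acyclic (del_vertices V A F)}"

definition adjacent :: "('a \<times> 'a) set \<Rightarrow> 'a \<Rightarrow> 'a \<Rightarrow> bool" where
  "adjacent A u v \<longleftrightarrow> (u, v) \<in> A \<or> (v, u) \<in> A"

definition degenerate :: "nat \<Rightarrow> 'a set \<Rightarrow> ('a \<times> 'a) set \<Rightarrow> bool" where
  "degenerate k V A \<longleftrightarrow> (\<exists>xs. distinct xs \<and> set xs = V \<and>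
     (\<forall>i < length xs. card {j. j < i \<and> adjacent A (xs ! i) (xs ! j)} \<le> k))"

end

theory Submission
  imports Defs
begin

text \<open>
  It suffices to find an acyclic set of at least \<open>2n/(k+1)\<close> vertices. This goes by
  induction: delete a set \<open>T\<close> containing a nonempty \<open>G\<close> with \<open>2|T| \<le> (k+1)|G|\<close> such
  that every acyclic set avoiding \<open>T\<close> remains acyclic after adding \<open>G\<close>. A vertex can be
  added as a source or as a sink once its in-neighbours or its out-neighbours are deleted.

  Let \<open>u\<close> be the last vertex in the degeneracy order having a later neighbour, and let \<open>v\<close> be
  such a neighbour; then \<open>v\<close> has degree at most \<open>k\<close>. If \<open>v\<close> has at most \<open>(k-1)/2\<close>
  in-neighbours or out-neighbours, delete these and take \<open>G = {v}\<close>. Otherwise \<open>k = 2m\<close>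
  and \<open>v\<close> has \<open>m\<close> neighbours of each kind. If \<open>u\<close> has two later neighbours \<open>v, w\<close>,
  then \<open>G = {v, w}\<close> works since the sides of \<open>v\<close> and \<open>w\<close> containing \<open>u\<close> overlap. If \<open>v\<close>
  is the only one, then \<open>G = {u, v}\<close> works.
\<close>

section \<open>Acyclic vertex sets and reducibility\<close>

abbreviation acyclic_on :: "('a \<times> 'a) set \<Rightarrow> 'a set \<Rightarrow> bool" where
  "acyclic_on A S \<equiv> acyclic (A \<inter> S \<times> S)"

definition in_nbs :: "('a \<times> 'a) set \<Rightarrow> 'a set \<Rightarrow> 'a \<Rightarrow> 'a set" where
  "in_nbs A W x = {y \<in> W. (y, x) \<in> A}"

definition out_nbs :: "('a \<times> 'a) set \<Rightarrow> 'a set \<Rightarrow> 'a \<Rightarrow> 'a set" where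
  "out_nbs A W x = {y \<in> W. (x, y) \<in> A}"

definition reducible :: "nat \<Rightarrow> ('a \<times> 'a) set \<Rightarrow> 'a set \<Rightarrow> bool" where
  "reducible k A W \<longleftrightarrow> (\<exists>T G. G \<subseteq> T \<and> T \<subseteq> W \<and> G \<noteq> {} \<and> 2 * card T \<le> (k + 1) * card G \<and>
     (\<forall>S \<subseteq> W - T. acyclic_on A S \<longrightarrow> acyclic_on A (S \<union> G)))"

lemma acyclic_on_converse: "acyclic_on (A\<inverse>) S \<longleftrightarrow> acyclic_on A S"
proof -
  have "A\<inverse> \<inter> S \<times> S = (A \<inter> S \<times> S)\<inverse>" by auto
  then show ?thesis by (metis acyclic_converse)
qed

lemma reducible_converse: "reducible k (A\<inverse>) W \<longleftrightarrow> reducible k A W"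
  unfolding reducible_def acyclic_on_converse ..

lemma in_nbs_converse: "in_nbs (A\<inverse>) W x = out_nbs A W x"
  and out_nbs_converse: "out_nbs (A\<inverse>) W x = in_nbs A W x"
  by (auto simp: in_nbs_def out_nbs_def)

text \<open>No arc of \<open>S\<close> ends in \<open>x\<close>, so the arcs from \<open>x\<close>
  and the arcs inside \<open>S\<close> form a union of two well-founded relations whose domain and
  range are disjoint in the order that \<open>wf_Un\<close> needs.\<close>

lemma acyclic_on_insert_source:
  assumes "finite S" "acyclic_on A S" "(x, x) \<notin> A" "\<And>y. y \<in> S \<Longrightarrow> (y, x) \<notin> A"
  shows "acyclic_on A (insert x S)"
proof (cases "x \<in> S")
  case True
  then show ?thesis using assms by (simp add: insert_absorb)
next
  case False
  have "finite (A \<inter> S \<times> S)" using assms(1) by simp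
  then have r: "wf (A \<inter> S \<times> S)" using assms(2) by (rule finite_acyclic_wf)
  have "acyclic ({x} \<times> S)" using False by (auto simp: acyclic_def dest: tranclD tranclD2)
  then have s: "wf ({x} \<times> S)" using assms(1) by (auto intro: finite_acyclic_wf)
  have "wf ({x} \<times> S \<union> A \<inter> S \<times> S)" by (rule wf_Un[OF s r]) (use False in auto)
  then have "acyclic ({x} \<times> S \<union> A \<inter> S \<times> S)" by (rule wf_acyclic)
  moreover have "A \<inter> insert x S \<times> insert x S \<subseteq> {x} \<times> S \<union> A \<inter> S \<times> S"
    using assms(3,4) by auto
  ultimately show ?thesis by (rule acyclic_subset)
qed

lemma acyclic_on_insert:
  assumes "finite W" "S \<subseteq> W" "acyclic_on A S" "(x, x) \<notin> A"
    and "in_nbs A W x \<inter> S = {} \<or> out_nbs A W x \<inter> S = {}"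
  shows "acyclic_on A (insert x S)"
  using assms(5)
proof
  have fin: "finite S" using assms(1,2) by (rule rev_finite_subset)
  show ?thesis if "in_nbs A W x \<inter> S = {}"
    using that assms(2) by (intro acyclic_on_insert_source fin assms) (auto simp: in_nbs_def)
  show ?thesis if "out_nbs A W x \<inter> S = {}"
  proof -
    have "acyclic_on (A\<inverse>) (insert x S)"
      using that assms(2-4) by (intro acyclic_on_insert_source fin)
        (auto simp: acyclic_on_converse out_nbs_def)
    then show ?thesis unfolding acyclic_on_converse .
  qed
qed

section \<open>Local configurations with one or two added vertices\<close>

lemma reducible_one:
  assumes "finite W" "x \<in> W" "(x, x) \<notin> A"
    and X: "X = in_nbs A W x \<or> X = out_nbs A W x" and card: "2 * (card X + 1) \<le> k + 1"
  shows "reducible k A W"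
  unfolding reducible_def
proof (intro exI conjI allI impI)
  show "{x} \<subseteq> insert x X" "{x} \<noteq> {}" by auto
  show "insert x X \<subseteq> W" using X assms(2) by (auto simp: in_nbs_def out_nbs_def)
  have "card (insert x X) \<le> card X + 1" by (simp add: card_insert_le_m1)
  then show "2 * card (insert x X) \<le> (k + 1) * card {x}" using card by simp
  fix S assume S: "S \<subseteq> W - insert x X" "acyclic_on A S"
  have "acyclic_on A (insert x S)"
    by (rule acyclic_on_insert[OF assms(1)]) (use S X assms(3) in auto)
  then show "acyclic_on A (S \<union> {x})" by simp
qed

text \<open>The set \<open>X\<close> only has to contain the neighbours of \<open>x\<close> of one kind other than \<open>y\<close>, because
  \<open>x\<close> is added before \<open>y\<close>.\<close>

lemma reducible_two:
  assumes "finite W" "x \<in> W" "y \<in> W" "x \<noteq> y" "(x, x) \<notin> A" "(y, y) \<notin> A"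
    and X: "X = in_nbs A W x - {y} \<or> X = out_nbs A W x - {y}"
    and Y: "Y = in_nbs A W y \<or> Y = out_nbs A W y" "x \<notin> Y"
    and card: "2 * card ({x, y} \<union> X \<union> Y) \<le> 2 * (k + 1)"
  shows "reducible k A W"
  unfolding reducible_def
proof (intro exI conjI allI impI)
  let ?T = "{x, y} \<union> X \<union> Y"
  show "{x, y} \<subseteq> ?T" "{x, y} \<noteq> {}" by auto
  show "?T \<subseteq> W" using assms(2,3) X Y by (auto simp: in_nbs_def out_nbs_def)
  show "2 * card ?T \<le> (k + 1) * card {x, y}" using card assms(4) by simp
  fix S assume S: "S \<subseteq> W - ?T" "acyclic_on A S"
  have "acyclic_on A (insert x S)"
    by (rule acyclic_on_insert[OF assms(1)]) (use S X assms(5) in auto)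
  then have "acyclic_on A (insert y (insert x S))"
    by (rule acyclic_on_insert[OF assms(1), rotated]) (use S Y assms(2,6) in auto)
  then show "acyclic_on A (S \<union> {x, y})" by (simp add: insert_commute)
qed

text \<open>This settles the case where \<open>v\<close> is the only later neighbour of
  \<open>u\<close>. The budget is \<open>2 * m + 1\<close> deleted vertices; whichever side of
  \<open>u\<close> is small decides which of the two is added first.\<close>

lemma reducible_arc:
  assumes "finite W" "u \<in> W" "v \<in> W" "(u, v) \<in> A"
    and asym: "\<And>x y. (x, y) \<in> A \<Longrightarrow> x \<noteq> y \<and> (y, x) \<notin> A"
    and v: "card (in_nbs A W v) \<le> m" "card (out_nbs A W v) \<le> m"
    and u: "card (in_nbs A W u) + card (out_nbs A W u - {v}) \<le> 2 * m"
  shows "reducible (2 * m) A W"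
proof -
  have fin: "finite (in_nbs A W x)" "finite (out_nbs A W x)" for x
    using assms(1) by (simp_all add: in_nbs_def out_nbs_def)
  have neq: "u \<noteq> v" and irr: "(u, u) \<notin> A" "(v, v) \<notin> A" and vu: "(v, u) \<notin> A"
    using asym assms(4) by blast+
  show ?thesis
  proof (cases "card (in_nbs A W u) \<le> m")
    case True
    \<comment> \<open>Here \<open>v\<close> is added before \<open>u\<close>. Since \<open>u\<close>
      is already counted among the \<open>m\<close> in-neighbours of \<open>v\<close>, only
      \<open>v\<close> itself is extra.\<close>
    have "u \<in> in_nbs A W v" using assms by (simp add: in_nbs_def)
    then have "{v, u} \<union> (in_nbs A W v - {u}) \<union> in_nbs A W u = insert v (in_nbs A W v \<union> in_nbs A W u)"
      by auto
    then have "card ({v, u} \<union> (in_nbs A W v - {u}) \<union> in_nbs A W u) \<le> Suc (m + m)"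
      using card_Un_le[of "in_nbs A W v" "in_nbs A W u"] True v fin
      by (simp add: card_insert_if)
    then show ?thesis
      by (intro reducible_two[where x = v and y = u and X = "in_nbs A W v - {u}" and Y = "in_nbs A W u"])
        (use assms(1-3) neq irr vu in \<open>auto simp: in_nbs_def\<close>)
  next
    case False
    \<comment> \<open>More than \<open>m\<close> in-neighbours leave \<open>u\<close> at most
      \<open>m - 1\<close> out-neighbours besides \<open>v\<close>, which makes room for both
      \<open>u\<close> and \<open>v\<close>.\<close>
    have "card (insert u (insert v ((out_nbs A W u - {v}) \<union> out_nbs A W v))) \<le>
        Suc (Suc (card (out_nbs A W u - {v}) + card (out_nbs A W v)))"
      using card_Un_le[of "out_nbs A W u - {v}" "out_nbs A W v"] fin neq
      by (simp add: card_insert_if)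
    moreover have "insert u (insert v ((out_nbs A W u - {v}) \<union> out_nbs A W v)) =
        {u, v} \<union> (out_nbs A W u - {v}) \<union> out_nbs A W v" by blast
    ultimately have "card ({u, v} \<union> (out_nbs A W u - {v}) \<union> out_nbs A W v) \<le>
        Suc (Suc (card (out_nbs A W u - {v}) + card (out_nbs A W v)))" by metis
    then have "card ({u, v} \<union> (out_nbs A W u - {v}) \<union> out_nbs A W v) \<le> Suc (2 * m)"
      using False u v by linarith
    then show ?thesis
      by (intro reducible_two[where x = u and y = v and X = "out_nbs A W u - {v}" and Y = "out_nbs A W v"])
        (use assms(1-3) neq irr vu in \<open>auto simp: out_nbs_def\<close>)
  qed
qed

section \<open>Finding a configuration at the end of the order\<close>

lemma reducible_of_rank:
  fixes r :: "'a \<Rightarrow> nat"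
  assumes "finite W" "W \<noteq> {}" "k \<ge> 1" "inj_on r W"
    and asym: "\<And>x y. (x, y) \<in> A \<Longrightarrow> x \<noteq> y \<and> (y, x) \<notin> A"
    and deg: "\<And>x. x \<in> W \<Longrightarrow> card {y \<in> W. r y < r x \<and> adjacent A x y} \<le> k"
  shows "reducible k A W"
proof -
  define E where "E = {y \<in> W. \<exists>x \<in> W. r y < r x \<and> adjacent A y x}"
  have fin: "finite (in_nbs A W x)" "finite (out_nbs A W x)" for x
    using assms(1) by (simp_all add: in_nbs_def out_nbs_def)
  have irr: "(x, x) \<notin> A" for x using asym by blast
  have nb: "r x < r y \<or> r y < r x" if "x \<in> W" "y \<in> W" "adjacent A x y" for x y
    using that assms(4) asym by (metis adjacent_def inj_onD linorder_neqE_nat)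
  show ?thesis
  proof (cases "E = {}")
    case True
    obtain x where x: "x \<in> W" using assms(2) by blast
    \<comment> \<open>Without later neighbours there are no arcs in \<open>W\<close>; the cost of
      deleting \<open>x\<close> alone is covered by \<open>k \<ge> 1\<close>.\<close>
    have "in_nbs A W x = {}"
      using True x nb[of _ x] by (fastforce simp: E_def in_nbs_def adjacent_def)
    then show ?thesis using assms(1,3) x irr
      by (intro reducible_one[where x = x and X = "{}"]) auto
  next
    case False
    have "finite E" using assms(1) by (simp add: E_def)
    obtain u where u: "u \<in> E" and umax: "\<And>y. y \<in> E \<Longrightarrow> r y \<le> r u"
      using Max_in[of "r ` E"] Max_ge[of "r ` E"] False \<open>finite E\<close>
      by (metis (no_types, lifting) finite_imageI image_iff image_is_empty imageI)
    then have uW: "u \<in> W" by (simp add: E_def)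
    \<comment> \<open>Used with \<open>Z = {}\<close> for vertices after \<open>u\<close>, and with
      \<open>Z = {v}\<close> for \<open>u\<close> itself.\<close>
    have sides: "card (in_nbs A W x - Z) + card (out_nbs A W x - Z) \<le> k"
      if "x \<in> W" "\<And>y. y \<in> W - Z \<Longrightarrow> adjacent A x y \<Longrightarrow> r y < r x" for x Z
    proof -
      have "card (in_nbs A W x - Z) + card (out_nbs A W x - Z)
          = card ((in_nbs A W x - Z) \<union> (out_nbs A W x - Z))"
        using fin asym by (intro card_Un_disjoint[symmetric]) (auto simp: in_nbs_def out_nbs_def)
      also have "\<dots> \<le> card {y \<in> W. r y < r x \<and> adjacent A x y}"
        using that assms(1) by (intro card_mono) (auto simp: in_nbs_def out_nbs_def adjacent_def)
      also have "\<dots> \<le> k" using deg that(1) .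
      finally show ?thesis .
    qed
    \<comment> \<open>By maximality of \<open>u\<close>, a vertex after \<open>u\<close> has no
      later neighbour.\<close>
    have late: "r y < r v" if "v \<in> W" "r u < r v" "y \<in> W" "adjacent A v y" for v y
      using umax[of v] nb[of v y] that by (auto simp: E_def)
    have late_sides: "card (in_nbs A W v) + card (out_nbs A W v) \<le> k" if "v \<in> W" "r u < r v" for v
      using sides[of v "{}"] late[OF that] that by auto
    obtain v where v: "v \<in> W" "r u < r v" "adjacent A u v" using u by (auto simp: E_def)
    show ?thesis
    proof (rule ccontr)
      assume nred: "\<not> reducible k A W"
      have big: "k \<le> 2 * card (in_nbs A W x)" "k \<le> 2 * card (out_nbs A W x)" if "x \<in> W" for x
        using reducible_one[of W x A "in_nbs A W x" k] reducible_one[of W x A "out_nbs A W x" k]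
          nred assms(1) that irr by force+
      define m where "m = card (in_nbs A W v)"
      \<comment> \<open>Both sides have at least \<open>k / 2\<close> elements and together at most
        \<open>k\<close>, so both are exactly half and \<open>k\<close> is even.\<close>
      have k: "k = 2 * m"
        using big[OF v(1)] late_sides[OF v(1,2)] by (simp add: m_def)
      have eq: "card (in_nbs A W x) = m" "card (out_nbs A W x) = m" if "x \<in> W" "r u < r x" for x
        using big[OF that(1)] late_sides[OF that] k by simp_all
      show False
      proof (cases "\<exists>w \<in> W. w \<noteq> v \<and> r u < r w \<and> adjacent A u w")
        case True
        then obtain w where w: "w \<in> W" "w \<noteq> v" "r u < r w" "adjacent A u w" by blast
        \<comment> \<open>Otherwise \<open>v\<close> and \<open>w\<close> would each precede the
          other.\<close>
        have nadj: "\<not> adjacent A v w"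
          using late[of v w] late[of w v] v w by (auto simp: adjacent_def)
        have "\<exists>X. (X = in_nbs A W x \<or> X = out_nbs A W x) \<and> u \<in> X" if "adjacent A u x" for x
          using that uW by (auto simp: adjacent_def in_nbs_def out_nbs_def)
        then obtain X Y where X: "X = in_nbs A W v \<or> X = out_nbs A W v" "u \<in> X"
          and Y: "Y = in_nbs A W w \<or> Y = out_nbs A W w" "u \<in> Y" using v(3) w(4) by metis
        have cX: "card X = m" and cY: "card Y = m" and fXY: "finite X" "finite Y"
          using X Y eq v w fin by auto
        \<comment> \<open>The common element \<open>u\<close> gives
          \<open>card (X \<union> Y) \<le> 2 * m - 1\<close>; adding \<open>v\<close> and
          \<open>w\<close> just meets the budget \<open>k + 1\<close>.\<close>
        have "card (X \<union> Y) + card (X \<inter> Y) = m + m"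
          using card_Un_Int[OF fXY] cX cY by simp
        moreover have "card (X \<inter> Y) \<ge> 1"
          using X Y fXY by (metis IntI One_nat_def Suc_leI card_gt_0_iff empty_iff finite_Int)
        ultimately have "card ({v, w} \<union> X \<union> Y) \<le> k + 1"
          using k fXY by (simp add: card_insert_if)
        moreover have "w \<notin> X" "v \<notin> Y"
          using nadj X Y by (auto simp: adjacent_def in_nbs_def out_nbs_def)
        ultimately have "reducible k A W"
          using assms(1) v w X Y irr
          by (intro reducible_two[where x = v and y = w and X = X and Y = Y]) auto
        then show False using nred by blast
      next
        case False
        have "r y < r u" if "y \<in> W - {v}" "adjacent A u y" for y
          using that False nb[of u y] uW by auto
        then have su: "card (in_nbs A W u - {v}) + card (out_nbs A W u - {v}) \<le> k"
          using sides[of u "{v}"] uW by blast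
        show False
        proof (cases "(u, v) \<in> A")
          case True
          then have "in_nbs A W u - {v} = in_nbs A W u" using asym by (auto simp: in_nbs_def)
          then show False
            using reducible_arc[of W u v A m] assms(1) uW v True asym eq su k nred by simp
        next
          case nuv: False
          then have vu: "(v, u) \<in> A" using v(3) by (auto simp: adjacent_def)
          then have "out_nbs A W u - {v} = out_nbs A W u" using asym by (auto simp: out_nbs_def)
          \<comment> \<open>Reversing all arcs preserves reducibility and turns this case into the
            previous one.\<close>
          then have su': "card (in_nbs (A\<inverse>) W u) + card (out_nbs (A\<inverse>) W u - {v}) \<le> 2 * m"
            using su k by (simp add: in_nbs_converse out_nbs_converse)
          have "(u, v) \<in> A\<inverse>" using vu by simp
          then have "reducible (2 * m) (A\<inverse>) W"
            by (rule reducible_arc[OF assms(1) uW v(1)])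
              (use asym eq v su' in \<open>auto simp: in_nbs_converse out_nbs_converse\<close>)
          then show False using nred k by (simp add: reducible_converse)
        qed
      qed
    qed
  qed
qed

section \<open>The induction and the passage from orderings to ranks\<close>

lemma large_acyclic_set:
  fixes r :: "'a \<Rightarrow> nat"
  assumes "finite W" "k \<ge> 1" "inj_on r W"
    and asym: "\<And>x y. (x, y) \<in> A \<Longrightarrow> x \<noteq> y \<and> (y, x) \<notin> A"
    and "\<And>x. x \<in> W \<Longrightarrow> card {y \<in> W. r y < r x \<and> adjacent A x y} \<le> k"
  shows "\<exists>S \<subseteq> W. acyclic_on A S \<and> 2 * card W \<le> (k + 1) * card S"
  using assms(1,3,5)
proof (induction W rule: finite_psubset_induct)
  case (psubset W)
  show ?case
  proof (cases "W = {}")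
    case True
    then show ?thesis by (auto simp: acyclic_def)
  next
    case False
    have "reducible k A W"
      by (rule reducible_of_rank[OF psubset.hyps False assms(2) psubset.prems(1) asym psubset.prems(2)])
    then obtain T G where TG: "G \<subseteq> T" "T \<subseteq> W" "G \<noteq> {}" "2 * card T \<le> (k + 1) * card G"
      and ext: "\<And>S. S \<subseteq> W - T \<Longrightarrow> acyclic_on A S \<Longrightarrow> acyclic_on A (S \<union> G)"
      unfolding reducible_def by blast
    have fin: "finite T" "finite G" using TG psubset.hyps by (meson finite_subset)+
    \<comment> \<open>Deleting vertices only shrinks the sets of earlier neighbours.\<close>
    have "card {y \<in> W - T. r y < r x \<and> adjacent A x y} \<le> k" if "x \<in> W - T" for x
    proof -
      have "card {y \<in> W - T. r y < r x \<and> adjacent A x y} \<le> card {y \<in> W. r y < r x \<and> adjacent A x y}"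
        using psubset.hyps by (intro card_mono) auto
      also have "\<dots> \<le> k" using psubset.prems(2) that by blast
      finally show ?thesis .
    qed
    moreover have "W - T \<subset> W" "inj_on r (W - T)"
      using TG psubset.prems(1) by (auto intro: inj_on_diff)
    ultimately obtain S where S: "S \<subseteq> W - T" "acyclic_on A S" "2 * card (W - T) \<le> (k + 1) * card S"
      using psubset.IH[of "W - T"] by blast
    have "card W = card (W - T) + card T"
      using TG fin psubset.hyps by (simp add: card_Diff_subset card_mono)
    moreover have "card (S \<union> G) = card S + card G"
      using S TG fin psubset.hyps by (intro card_Un_disjoint) (auto intro: finite_subset)
    ultimately have "2 * card W \<le> (k + 1) * card (S \<union> G)"
      using S(3) TG(4) by (simp add: algebra_simps)
    then show ?thesis using ext[OF S(1,2)] S(1) TG(1,2) by (intro exI[of _ "S \<union> G"]) auto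
  qed
qed

text \<open>The rank is the position in the list. Unlike list positions, it needs no renumbering
  when vertices are deleted, which suits the induction.\<close>

lemma degenerate_rank:
  assumes "degenerate k V A"
  obtains r :: "'a \<Rightarrow> nat" where "inj_on r V"
    and "\<And>x. x \<in> V \<Longrightarrow> card {y \<in> V. r y < r x \<and> adjacent A x y} \<le> k"
proof -
  obtain xs where xs: "distinct xs" "set xs = V"
    and deg: "\<And>i. i < length xs \<Longrightarrow> card {j. j < i \<and> adjacent A (xs ! i) (xs ! j)} \<le> k"
    using assms unfolding degenerate_def by blast
  define r where "r = the_inv_into {..<length xs} ((!) xs)"
  have bij: "bij_betw ((!) xs) {..<length xs} V" using xs by (simp add: bij_betw_nth)
  have r: "r (xs ! i) = i" if "i < length xs" for i
    using that bij by (simp add: r_def bij_betw_def the_inv_into_f_f)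
  have ex: "\<exists>i < length xs. x = xs ! i" if "x \<in> V" for x
    using that xs(2) by (metis in_set_conv_nth)
  have "inj_on r V" by (rule inj_onI) (metis ex r)
  moreover have "card {y \<in> V. r y < r x \<and> adjacent A x y} \<le> k" if x: "x \<in> V" for x
  proof -
    obtain i where i: "i < length xs" "x = xs ! i" using ex x by blast
    have "{y \<in> V. r y < r x \<and> adjacent A x y} \<subseteq> (!) xs ` {j. j < i \<and> adjacent A (xs ! i) (xs ! j)}"
      using ex r i by fastforce
    then have "card {y \<in> V. r y < r x \<and> adjacent A x y} \<le> card {j. j < i \<and> adjacent A (xs ! i) (xs ! j)}"
      by (rule surj_card_le[rotated]) simp
    then show ?thesis using deg[OF i(1)] by simp
  qed
  ultimately show ?thesis using that by blast
qed

theorem mainTheorem5: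
  fixes V :: "'a set" and A :: "('a \<times> 'a) set" and k :: nat
  assumes "k \<ge> 1"
    and "oriented_graph V A"
    and "degenerate k V A"
  shows "real (fvs_number V A) \<le> (real k - 1) / (real k + 1) * real (card V)"
proof -
  have fin: "finite V" and asym: "\<And>x y. (x, y) \<in> A \<Longrightarrow> x \<noteq> y \<and> (y, x) \<notin> A"
    using assms(2) by (auto simp: oriented_graph_def)
  obtain r :: "'a \<Rightarrow> nat" where "inj_on r V"
    and "\<And>x. x \<in> V \<Longrightarrow> card {y \<in> V. r y < r x \<and> adjacent A x y} \<le> k"
    using degenerate_rank[OF assms(3)] by blast
  then obtain S where S: "S \<subseteq> V" "acyclic_on A S" "2 * card V \<le> (k + 1) * card S"
    using large_acyclic_set[OF fin assms(1) _ asym] by blast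
  \<comment> \<open>The complement of \<open>S\<close> serves as the feedback vertex set.\<close>
  have "V - (V - S) = S" using S(1) by blast
  then have "acyclic (del_vertices V A (V - S))" using S(2) by (simp add: del_vertices_def)
  then have "card (V - S) \<in> {card F | F. F \<subseteq> V \<and> acyclic (del_vertices V A F)}" by blast
  moreover have "finite {card F | F. F \<subseteq> V \<and> acyclic (del_vertices V A F)}"
    using fin by simp
  ultimately have "fvs_number V A \<le> card (V - S)"
    unfolding fvs_number_def by (intro Min_le)
  then have "real (fvs_number V A) \<le> real (card V) - real (card S)"
    using S(1) fin card_mono[OF fin S(1)] by (simp add: card_Diff_subset finite_subset)
  moreover have "2 * real (card V) \<le> (real k + 1) * real (card S)"
    using of_nat_mono[OF S(3), where 'a = real] by (simp add: algebra_simps)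
  \<comment> \<open>Subtracting \<open>card S\<close>, which is at least \<open>2 / (k + 1)\<close>
    times \<open>card V\<close>, leaves the factor
    \<open>1 - 2 / (k + 1) = (k - 1) / (k + 1)\<close>.\<close>
  ultimately show ?thesis
    by (simp add: field_simps) (smt (verit) mult_left_mono of_nat_0_le_iff distrib_left)
qed

end
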